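(* Let $F:L_k^2\to L_k$ be an associative quasitrivial nondecreasing operation. Then there exist half-neutral elements $a,b\in L_k$ of $F$ with $a\le b$ (that is, $a=\min\{e,f\}$ and $b=\max\{e,f\}$, where $e$ is the upper and $f$ the lower half-neutral element of $F$) and a downward-right path $\mathcal{P}=(p_j)_{j=1}^l$ (for some $l\in\mathbb{N}$, $l\le k$) from $p_1=(1,k)$ to $p_l=(a,b)$ such that, with $\mathcal{Q}=(q_j)_{j=1}^l$ denoting the reflection of $\mathcal{P}$ in the diagonal, the following hold. (1) For every $(x,y)\notin\mathcal{P}\cup\mathcal{Q}$: $F(x,y)=x\vee y$ if $(x,y)$ is above $\mathcal{P}\cup\mathcal{Q}$; $F(x,y)=x\wedge y$ if $(x,y)$ is below $\mathcal{P}\cup\mathcal{Q}$; and $F$ is $Proj_x$ or $Proj_y$ if $(x,y)\in[a,b]^2$. (2) For every $(x,y)\in\mathcal{P}\cup\mathcal{Q}$: $F(x,y)=x\wedge y$ if $(x,y)=p_i$ or $q_i$ and $\overline{p_i,p_{i+1}}$ is horizontal; $F(x,y)=x\vee y$ if $(x,y)=p_i$ or $q_i$ and $\overline{p_i,p_{i+1}}$ is vertical; $F(x,y)$ is $x$ or $y$ if $(x,y)=p_i$ and $\overline{p_i,p_{i+1}}$ is diagonal; $F(x,y)$ is $x$ or $y$ if $(x,y)=q_i$ and $\overline{q_i,q_{i+1}}$ is diagonal. (3) If $a$ is the lower half-neutral element $f$ and $b$ is the upper half-neutral element $e$, then $F$ is $Proj_x$ on $[a,b]^2$; otherwise it is $Proj_y$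 on $[a,b]^2$. (4) Moreover, $F$ is symmetric except on $[a,b]^2$ and at the points $p_i\in\mathcal{P}$ and $q_i\in\mathcal{Q}$ where $\overline{p_i,p_{i+1}}$ is diagonal ($i\in\{1,\dots,l-1\}$).
   Context: $L_k=\{1,\dots,k\}$ with the natural order; $[a,b]=\{m\in L_k: a\le m\le b\}$; $x\wedge y=\min\{x,y\}$, $x\vee y=\max\{x,y\}$; $Proj_x(x,y)=x$ and $Proj_y(x,y)=y$. The diagonal is $\{(x,x):x\in L_k\}$. An operation $F:L_k^2\to L_k$ is quasitrivial if $F(x,y)\in\{x,y\}$ for all $x,y$; associative if $F(F(x,y),z)=F(x,F(y,z))$ for all $x,y,z$; nondecreasing if $F(x,y)\le F(x',y')$ whenever $x\le x'$ and $y\le y'$; symmetric at $(x,y)$ means $F(x,y)=F(y,x)$. The upper symmetrization of $F$ is $F_1(x,y)=F(x\wedge y,x\vee y)$ and the lower symmetrization is $F_2(x,y)=F(x\vee y,x\wedge y)$. The upper half-neutral element $e$ of $F$ is the neutral element of $F_1$ (i.e. $F_1(e,x)=F_1(x,e)=x$ for all $x$); the lower half-neutral element $f$ of $F$ is the neutral element of $F_2$. A downward-right path is a finite sequence of points $(p_j)_{j=1}^l$ of $L_k^2$, together with the line segments $\overline{p_j,p_{j+1}}$ joining consecutive points, such that each step from $p_j=(x,y)$ to $p_{j+1}$ goes to $(x+1,y)$ (the segment is horizontal), to $(x,y-1)$ (vertical), or to $(x+1,y-1)$ (diagonal). As a subset of $L_k^2$, $\mathcal{P}$ is the set of its points $p_1,\dots,p_l$.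 The reflection of $\mathcal{P}$ in the diagonal is $\mathcal{Q}=(q_j)_{j=1}^l$, where $q_j=(y,x)$ if $p_j=(x,y)$. Let $\mathcal{P}$ be a downward-right path from $(1,k)$ to $(a,b)$, $a\le b$, with reflection $\mathcal{Q}$, and let $(x,y)\in L_k^2\setminus(\mathcal{P}\cup\mathcal{Q}\cup[a,b]^2)$. Then $(x,y)$ is above $\mathcal{P}\cup\mathcal{Q}$ if there is $(x,w)\in\mathcal{P}$ with $y>w$ or there is $(w,y)\in\mathcal{Q}$ with $x>w$. It is below $\mathcal{P}\cup\mathcal{Q}$ if there is $(x,w)\in\mathcal{P}$ with $y<w$ or there is $(w,y)\in\mathcal{Q}$ with $x<w$. *)

theory Defs
  imports Main
begin

definition L :: "nat \<Rightarrow> nat set" where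
  "L k = {1..k}"

definition operation_on :: "nat \<Rightarrow> (nat \<Rightarrow> nat \<Rightarrow> nat) \<Rightarrow> bool" where
  "operation_on k F \<longleftrightarrow> (\<forall>x\<in>L k. \<forall>y\<in>L k. F x y \<in> L k)"

definition quasitrivial :: "nat \<Rightarrow> (nat \<Rightarrow> nat \<Rightarrow> nat) \<Rightarrow> bool" where
  "quasitrivial k F \<longleftrightarrow> (\<forall>x\<in>L k. \<forall>y\<in>L k. F x y \<in> {x, y})"

definition associative :: "nat \<Rightarrow> (nat \<Rightarrow> nat \<Rightarrow> nat) \<Rightarrow> bool" where
  "associative k F \<longleftrightarrow>
     (\<forall>x\<in>L k. \<forall>y\<in>L k. \<forall>z\<in>L k. F (F x y) z = F x (F y z))"

definition nondecreasing :: "nat \<Rightarrow> (nat \<Rightarrow> nat \<Rightarrow> nat) \<Rightarrow> bool" where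
  "nondecreasing k F \<longleftrightarrow>
     (\<forall>x\<in>L k. \<forall>y\<in>L k. \<forall>x'\<in>L k. \<forall>y'\<in>L k. x \<le> x' \<longrightarrow> y \<le> y' \<longrightarrow> F x y \<le> F x' y')"

definition Proj_x :: "nat \<Rightarrow> nat \<Rightarrow> nat" where
  "Proj_x x y = x"

definition Proj_y :: "nat \<Rightarrow> nat \<Rightarrow> nat" where
  "Proj_y x y = y"

definition agrees_on :: "(nat \<times> nat) set \<Rightarrow> (nat \<Rightarrow> nat \<Rightarrow> nat) \<Rightarrow> (nat \<Rightarrow> nat \<Rightarrow> nat) \<Rightarrow> bool" where
  "agrees_on S F G \<longleftrightarrow> (\<forall>(x, y)\<in>S. F x y = G x y)"

definition symmetric_at :: "(nat \<Rightarrow> nat \<Rightarrow> nat) \<Rightarrow> nat \<times> nat \<Rightarrow> bool" where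
  "symmetric_at F z \<longleftrightarrow> F (fst z) (snd z) = F (snd z) (fst z)"

definition upper_symmetrization :: "(nat \<Rightarrow> nat \<Rightarrow> nat) \<Rightarrow> nat \<Rightarrow> nat \<Rightarrow> nat" where
  "upper_symmetrization F x y = F (min x y) (max x y)"

definition lower_symmetrization :: "(nat \<Rightarrow> nat \<Rightarrow> nat) \<Rightarrow> nat \<Rightarrow> nat \<Rightarrow> nat" where
  "lower_symmetrization F x y = F (max x y) (min x y)"

definition neutral :: "nat \<Rightarrow> (nat \<Rightarrow> nat \<Rightarrow> nat) \<Rightarrow> nat \<Rightarrow> bool" where
  "neutral k G e \<longleftrightarrow> e \<in> L k \<and> (\<forall>x\<in>L k. G e x = x \<and> G x e = x)"

definition upper_half_neutral :: "nat \<Rightarrow> (nat \<Rightarrow> nat \<Rightarrow> nat) \<Rightarrow> nat \<Rightarrow> bool" where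
  "upper_half_neutral k F e \<longleftrightarrow> neutral k (upper_symmetrization F) e"

definition lower_half_neutral :: "nat \<Rightarrow> (nat \<Rightarrow> nat \<Rightarrow> nat) \<Rightarrow> nat \<Rightarrow> bool" where
  "lower_half_neutral k F f \<longleftrightarrow> neutral k (lower_symmetrization F) f"

text \<open>The vertical and diagonal steps are written with \<open>y = y' + 1\<close> rather than
  \<open>y' = y - 1\<close> because subtraction on \<^typ>\<open>nat\<close> truncates.\<close>

definition horizontal :: "nat \<times> nat \<Rightarrow> nat \<times> nat \<Rightarrow> bool" where
  "horizontal p p' \<longleftrightarrow> fst p' = fst p + 1 \<and> snd p' = snd p"

definition vertical :: "nat \<times> nat \<Rightarrow> nat \<times> nat \<Rightarrow> bool" where
  "vertical p p' \<longleftrightarrow> fst p' = fst p \<and> snd p = snd p' + 1"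

definition diagonal_step :: "nat \<times> nat \<Rightarrow> nat \<times> nat \<Rightarrow> bool" where
  "diagonal_step p p' \<longleftrightarrow> fst p' = fst p + 1 \<and> snd p = snd p' + 1"

text \<open>Being diagonal is a property of the unoriented segment: the reflection of a diagonal
  step of a downward-right path runs from \<open>(y, x)\<close> to \<open>(y - 1, x + 1)\<close>.\<close>

definition diagonal :: "nat \<times> nat \<Rightarrow> nat \<times> nat \<Rightarrow> bool" where
  "diagonal p p' \<longleftrightarrow> diagonal_step p p' \<or> diagonal_step p' p"

text \<open>A path \<open>p\<^sub>1, \<dots>, p\<^sub>l\<close> is a nonempty list, so \<open>p\<^sub>i\<close> is \<open>ps ! (i - 1)\<close> and
  its underlying point set is \<open>set ps\<close>.\<close>

definition downward_right_path :: "nat \<Rightarrow> (nat \<times> nat) list \<Rightarrow> bool" where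
  "downward_right_path k ps \<longleftrightarrow>
     ps \<noteq> [] \<and> set ps \<subseteq> L k \<times> L k \<and>
     (\<forall>i. Suc i < length ps \<longrightarrow>
        horizontal (ps ! i) (ps ! Suc i) \<or>
        vertical (ps ! i) (ps ! Suc i) \<or>
        diagonal_step (ps ! i) (ps ! Suc i))"

definition path_from_to :: "nat \<Rightarrow> (nat \<times> nat) list \<Rightarrow> nat \<times> nat \<Rightarrow> nat \<times> nat \<Rightarrow> bool" where
  "path_from_to k ps z w \<longleftrightarrow> downward_right_path k ps \<and> hd ps = z \<and> last ps = w"

definition reflection :: "(nat \<times> nat) list \<Rightarrow> (nat \<times> nat) list" where
  "reflection ps = map prod.swap ps"

text \<open>For a path ending in \<open>(a, b)\<close> these two relations do not exhaust the complement of the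
  paths and of \<open>[a, b]\<^sup>2\<close>: all first coordinates of the path are at most \<open>a\<close>, so a point
  with both coordinates greater than \<open>a\<close> is neither above nor below.\<close>

definition above_paths :: "nat \<Rightarrow> nat \<Rightarrow> nat \<Rightarrow> (nat \<times> nat) list \<Rightarrow> nat \<times> nat \<Rightarrow> bool" where
  "above_paths k a b ps z \<longleftrightarrow>
     z \<in> L k \<times> L k - (set ps \<union> set (reflection ps) \<union> {a..b} \<times> {a..b}) \<and>
     ((\<exists>w. (fst z, w) \<in> set ps \<and> snd z > w) \<or>
      (\<exists>w. (w, snd z) \<in> set (reflection ps) \<and> fst z > w))"

definition below_paths :: "nat \<Rightarrow> nat \<Rightarrow> nat \<Rightarrow> (nat \<times> nat) list \<Rightarrow> nat \<times> nat \<Rightarrow> bool" where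
  "below_paths k a b ps z \<longleftrightarrow>
     z \<in> L k \<times> L k - (set ps \<union> set (reflection ps) \<union> {a..b} \<times> {a..b}) \<and>
     ((\<exists>w. (fst z, w) \<in> set ps \<and> snd z < w) \<or>
      (\<exists>w. (w, snd z) \<in> set (reflection ps) \<and> fst z < w))"

end

(* The chain is peeled from the outside. On an interval [p, q] look at the two corner values
   F p q and F q p. If both are p, then p is absorbing on [p, q], and the path moves
   horizontally; if both are q, it moves vertically. If they differ, then either F is a
   projection on the whole interval and the path stops, or both endpoints absorb everything
   strictly between them and the path moves diagonally. Half-neutral elements of the final
   block stay half-neutral because everything peeled off before is absorbing. *)
theory Submission
  imports Defs
begin

section \<open>Peelings and the shape of their paths\<close>

definition absorbing_on :: "nat set \<Rightarrow> (nat \<Rightarrow> nat \<Rightarrow> nat) \<Rightarrow> nat \<Rightarrow> bool" where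
  "absorbing_on S F c \<longleftrightarrow> (\<forall>z\<in>S. F c z = c \<and> F z c = c)"

text \<open>The head \<open>(p, q)\<close> of the list stands for the interval [p, q] still to be
  treated, and the rules record only absorption facts, so their consequences are proved by rule
  induction alone. In \<open>diagonal\<close> each endpoint absorbs everything except the opposite
  one; the values at \<open>(p, Suc q)\<close> and its mirror image stay free. Naming the second
  point in each rule ties the step of the path to the rule.\<close>

inductive peeling :: "(nat \<Rightarrow> nat \<Rightarrow> nat) \<Rightarrow> (nat \<times> nat) list \<Rightarrow> bool" for F where
  stop: "a \<le> b \<Longrightarrow>
    agrees_on ({a..b} \<times> {a..b}) F Proj_x \<or> agrees_on ({a..b} \<times> {a..b}) F Proj_y \<Longrightarrow>
    peeling F [(a, b)]"
| horizontal: "absorbing_on {p..q} F p \<Longrightarrow> peeling F ((Suc p, q) # ps) \<Longrightarrow>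
    peeling F ((p, q) # (Suc p, q) # ps)"
| vertical: "absorbing_on {p..Suc q} F (Suc q) \<Longrightarrow> peeling F ((p, q) # ps) \<Longrightarrow>
    peeling F ((p, Suc q) # (p, q) # ps)"
| diagonal: "absorbing_on {p..q} F p \<Longrightarrow> absorbing_on {Suc p..Suc q} F (Suc q) \<Longrightarrow>
    peeling F ((Suc p, q) # ps) \<Longrightarrow> peeling F ((p, Suc q) # (Suc p, q) # ps)"

lemma peeling_nonempty: "peeling F ps \<Longrightarrow> ps \<noteq> []"
  by (auto elim: peeling.cases)

lemma peeling_last_ordered: "peeling F ps \<Longrightarrow> fst (last ps) \<le> snd (last ps)"
  by (induction rule: peeling.induct) auto

lemma peeling_last_projection:
  assumes "peeling F ps" and "last ps = (a, b)"
  shows "agrees_on ({a..b} \<times> {a..b}) F Proj_x \<or> agrees_on ({a..b} \<times> {a..b}) F Proj_y"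
  using assms by (induction rule: peeling.induct) auto

text \<open>Each step can only raise the first coordinate and lower the second. Hence removed
  endpoints do not recur later, and the final block lies inside every remaining interval.\<close>

lemma peeling_range:
  assumes "peeling F ps" and "(x, y) \<in> set ps"
  shows "fst (hd ps) \<le> x \<and> x \<le> fst (last ps) \<and> snd (last ps) \<le> y \<and> y \<le> snd (hd ps)"
  using assms
proof (induction arbitrary: x y rule: peeling.induct)
  case (horizontal p q ps)
  show ?case using horizontal.IH[of "Suc p" q] horizontal.IH[of x y] horizontal.prems by auto
next
  case (vertical p q ps)
  show ?case using vertical.IH[of p q] vertical.IH[of x y] vertical.prems by auto
next
  case (diagonal p q ps)
  show ?case using diagonal.IH[of "Suc p" q] diagonal.IH[of x y] diagonal.prems by auto
qed auto

text \<open>Each step shrinks the interval by at least one, and the last interval is nonempty. The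
  additive form avoids truncated subtraction and also orders the two coordinates of the
  head.\<close>

lemma peeling_length:
  "peeling F ps \<Longrightarrow> length ps + fst (hd ps) \<le> Suc (snd (hd ps))"
  by (induction rule: peeling.induct) auto

lemma peeling_step:
  assumes "peeling F ps" and "Suc i < length ps"
  shows "horizontal (ps ! i) (ps ! Suc i) \<or> vertical (ps ! i) (ps ! Suc i) \<or>
    diagonal_step (ps ! i) (ps ! Suc i)"
  using assms
  by (induction arbitrary: i rule: peeling.induct)
     (auto simp: nth_Cons horizontal_def vertical_def diagonal_step_def split: nat.splits)

text \<open>The shape of a step determines the rule that produced it, here one where the lower
  endpoint absorbs. Having both orders of the arguments covers the reflected point as well, and
  \<open>x \<le> y\<close> identifies the value as the minimum.\<close>

lemma peeling_horizontal:
  assumes "peeling F ps" and "Suc i < length ps"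
    and "horizontal (ps ! i) (ps ! Suc i)" and "ps ! i = (x, y)"
  shows "x \<le> y \<and> F x y = x \<and> F y x = x"
  using assms
proof (induction arbitrary: i rule: peeling.induct)
  case (horizontal p q ps)
  have "p < q" using peeling_length[OF horizontal.hyps(2)] by simp
  with horizontal show ?case
    by (cases i) (auto simp: absorbing_on_def)
next
  case (vertical p q ps)
  then show ?case by (cases i) (auto simp: horizontal_def)
next
  case (diagonal p q ps)
  then show ?case by (cases i) (auto simp: horizontal_def)
qed auto

lemma peeling_vertical:
  assumes "peeling F ps" and "Suc i < length ps"
    and "vertical (ps ! i) (ps ! Suc i)" and "ps ! i = (x, y)"
  shows "x \<le> y \<and> F x y = y \<and> F y x = y"
  using assms
proof (induction arbitrary: i rule: peeling.induct)
  case (horizontal p q ps)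
  then show ?case by (cases i) (auto simp: vertical_def)
next
  case (vertical p q ps)
  have "p \<le> q" using peeling_length[OF vertical.hyps(2)] by simp
  with vertical show ?case
    by (cases i) (auto simp: absorbing_on_def)
next
  case (diagonal p q ps)
  then show ?case by (cases i) (auto simp: vertical_def)
qed auto

section \<open>Half-neutral elements of the final block are global\<close>

lemma peeling_upper_neutral:
  assumes "peeling F ps" and "last ps = (a, b)" and "e \<in> {a..b}"
    and "\<And>x. x \<in> {a..b} \<Longrightarrow> upper_symmetrization F e x = x"
    and "x \<in> {fst (hd ps)..snd (hd ps)}"
  shows "upper_symmetrization F e x = x"
  using assms
proof (induction arbitrary: x rule: peeling.induct)
  case (horizontal p q ps)
  \<comment> \<open>The endpoint \<open>(a, b)\<close> lies on the rest of the path, so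
    \<open>e\<close> lies in the remaining interval and is absorbed by the removed
    \<open>p\<close>.\<close>
  have "Suc p \<le> e" "e \<le> q"
    using peeling_range[OF horizontal.hyps(2), of a b] horizontal.prems
      last_in_set[of "(Suc p, q) # ps"] by auto
  then show ?case using horizontal
    by (cases "x = p") (auto simp: absorbing_on_def upper_symmetrization_def)
next
  case (vertical p q ps)
  have "p \<le> e" "e \<le> q"
    using peeling_range[OF vertical.hyps(2), of a b] vertical.prems
      last_in_set[of "(p, q) # ps"] by auto
  then show ?case using vertical
    by (cases "x = Suc q") (auto simp: absorbing_on_def upper_symmetrization_def)
next
  case (diagonal p q ps)
  have "Suc p \<le> e" "e \<le> q"
    using peeling_range[OF diagonal.hyps(3), of a b] diagonal.prems
      last_in_set[of "(Suc p, q) # ps"] by auto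
  then consider "x = p" "F p e = p" | "x = Suc q" "F e (Suc q) = Suc q" | "x \<in> {Suc p..q}"
    using diagonal.hyps(1,2) diagonal.prems(4) by (fastforce simp: absorbing_on_def)
  then show ?case
  proof cases
    case 1
    then have "min e x = p" "max e x = e" using \<open>Suc p \<le> e\<close> by auto
    then show ?thesis using 1 by (simp add: upper_symmetrization_def)
  next
    case 2
    then have "min e x = e" "max e x = Suc q" using \<open>e \<le> q\<close> by auto
    then show ?thesis using 2 by (simp add: upper_symmetrization_def)
  next
    case 3
    then have "x \<in> {fst (hd ((Suc p, q) # ps))..snd (hd ((Suc p, q) # ps))}" by simp
    moreover have "last ((Suc p, q) # ps) = (a, b)" using diagonal.prems(1) by simp
    ultimately show ?thesis using diagonal.IH diagonal.prems(2,3) by blast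
  qed
qed auto

text \<open>Absorption is two-sided and the opposite operation merely exchanges the projections.
  Lower half-neutral elements thus become upper ones of the opposite operation.\<close>

lemma peeling_swap: "peeling F ps \<Longrightarrow> peeling (\<lambda>x y. F y x) ps"
proof (induction rule: peeling.induct)
  case (stop a b)
  then show ?case
    by (intro peeling.stop) (auto simp: agrees_on_def Proj_x_def Proj_y_def)
qed (auto simp: absorbing_on_def intro!: peeling.intros(2-))

lemma lower_symmetrization_eq:
  "lower_symmetrization F = upper_symmetrization (\<lambda>x y. F y x)"
  by (intro ext) (simp add: lower_symmetrization_def upper_symmetrization_def)

lemma upper_symmetrization_commute: "upper_symmetrization F x y = upper_symmetrization F y x"
  by (simp add: upper_symmetrization_def min.commute max.commute)

lemma peeling_upper_half_neutral:
  assumes "peeling F ps" and "hd ps = (1, k)" and "last ps = (a, b)" and "e \<in> {a..b}"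
    and "\<And>x. x \<in> {a..b} \<Longrightarrow> upper_symmetrization F e x = x"
  shows "upper_half_neutral k F e"
proof -
  have "(a, b) \<in> set ps" using assms(1,3) peeling_nonempty last_in_set by metis
  then have "e \<in> L k" using peeling_range[OF assms(1), of a b] assms(2-4) by (auto simp: L_def)
  moreover have "upper_symmetrization F e x = x" if "x \<in> L k" for x
    using peeling_upper_neutral[OF assms(1,3,4,5), of x] that assms(2) by (auto simp: L_def)
  ultimately show ?thesis
    by (auto simp: upper_half_neutral_def neutral_def upper_symmetrization_commute[of F _ e])
qed

lemma peeling_half_neutral:
  assumes "peeling F ps" and "hd ps = (1, k)" and "last ps = (a, b)" and "e \<in> {a, b}"
    and "\<And>x. x \<in> {a..b} \<Longrightarrow> upper_symmetrization F e x = x"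
    and "f \<in> {a, b}"
    and "\<And>x. x \<in> {a..b} \<Longrightarrow> lower_symmetrization F f x = x"
  shows "upper_half_neutral k F e \<and> lower_half_neutral k F f"
proof
  have ab: "a \<le> b" using peeling_last_ordered[OF assms(1)] assms(3) by simp
  show "upper_half_neutral k F e"
    using peeling_upper_half_neutral[OF assms(1-3)] assms(4,5) ab by auto
  have "upper_half_neutral k (\<lambda>x y. F y x) f"
    using peeling_upper_half_neutral[OF peeling_swap[OF assms(1)] assms(2-3)] assms(6,7) ab
    by (auto simp: lower_symmetrization_eq)
  then show "lower_half_neutral k F f"
    by (simp add: lower_half_neutral_def upper_half_neutral_def lower_symmetrization_eq)
qed

section \<open>Values off the path, and symmetry\<close>

text \<open>A removed upper endpoint absorbs its partner, which yields the maximum. A removed lower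
  endpoint is never a coordinate of a point above: its path point carries the top of the current
  interval, and every witness \<open>w\<close> exceeds it.\<close>

lemma peeling_above:
  assumes "peeling F ps" and "last ps = (a, b)"
    and "x \<in> {fst (hd ps)..snd (hd ps)}" and "y \<in> {fst (hd ps)..snd (hd ps)}"
    and "(\<exists>w. (x, w) \<in> set ps \<and> y > w) \<or> (\<exists>w. (y, w) \<in> set ps \<and> x > w)"
  shows "F x y = max x y"
  using assms
proof (induction arbitrary: x y rule: peeling.induct)
  case (horizontal p q ps)
  have r: "Suc p \<le> u \<and> u \<le> a \<and> a \<le> b \<and> b \<le> v \<and> v \<le> q" if "(u, v) \<in> set ((Suc p, q) # ps)" for u v
    using peeling_range[OF horizontal.hyps(2) that] peeling_last_ordered[OF horizontal.hyps(2)]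
      horizontal.prems(1) by auto
  have "x \<noteq> p" "y \<noteq> p" using horizontal.prems r by force+
  then show ?case using horizontal.prems by (intro horizontal.IH) auto
next
  case (vertical p q ps)
  have "p \<le> q" using peeling_length[OF vertical.hyps(2)] by simp
  show ?case
  proof (cases "x = Suc q \<or> y = Suc q")
    case True
    then show ?thesis using vertical.hyps(1) vertical.prems(2,3) \<open>p \<le> q\<close>
      by (auto simp: absorbing_on_def)
  next
    case False
    then show ?thesis using vertical.prems by (intro vertical.IH) auto
  qed
next
  case (diagonal p q ps)
  have r: "Suc p \<le> u \<and> u \<le> a \<and> a \<le> b \<and> b \<le> v \<and> v \<le> q" if "(u, v) \<in> set ((Suc p, q) # ps)" for u v
    using peeling_range[OF diagonal.hyps(3) that] peeling_last_ordered[OF diagonal.hyps(3)]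
      diagonal.prems(1) by auto
  have n: "x \<noteq> p" "y \<noteq> p" using diagonal.prems r by force+
  show ?case
  proof (cases "x = Suc q \<or> y = Suc q")
    case True
    then show ?thesis using diagonal.hyps(2) diagonal.prems(2,3) n r[of "Suc p" q]
      by (auto simp: absorbing_on_def)
  next
    case False
    then show ?thesis using diagonal.prems n by (intro diagonal.IH) auto
  qed
qed auto

text \<open>Here removed lower endpoints absorb and give the minimum, while a removed upper endpoint
  exceeds all later first coordinates and bounds all witnesses \<open>w\<close>. Excluding the final
  square settles the case \<open>stop\<close>.\<close>

lemma peeling_below:
  assumes "peeling F ps" and "last ps = (a, b)"
    and "x \<in> {fst (hd ps)..snd (hd ps)}" and "y \<in> {fst (hd ps)..snd (hd ps)}"
    and "(x, y) \<notin> set ps" and "(y, x) \<notin> set ps" and "(x, y) \<notin> {a..b} \<times> {a..b}"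
    and "(\<exists>w. (x, w) \<in> set ps \<and> y < w) \<or> (\<exists>w. (y, w) \<in> set ps \<and> x < w)"
  shows "F x y = min x y"
  using assms
proof (induction arbitrary: x y rule: peeling.induct)
  case (horizontal p q ps)
  show ?case
  proof (cases "x = p \<or> y = p")
    case True
    then show ?thesis using horizontal.hyps(1) horizontal.prems(2,3) by (auto simp: absorbing_on_def)
  next
    case False
    then show ?thesis using horizontal.prems by (intro horizontal.IH) auto
  qed
next
  case (vertical p q ps)
  have r: "p \<le> u \<and> u \<le> a \<and> a \<le> b \<and> b \<le> v \<and> v \<le> q" if "(u, v) \<in> set ((p, q) # ps)" for u v
    using peeling_range[OF vertical.hyps(2) that] peeling_last_ordered[OF vertical.hyps(2)]
      vertical.prems(1) by auto
  have n: "x \<noteq> Suc q" "y \<noteq> Suc q" using vertical.prems r by force+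
  \<comment> \<open>A point directly below the removed corner is not \<open>(p, q)\<close>, hence is below that too.\<close>
  have "(\<exists>w. (x, w) \<in> set ((p, q) # ps) \<and> y < w) \<or> (\<exists>w. (y, w) \<in> set ((p, q) # ps) \<and> x < w)"
  proof -
    have "y < q" if "x = p" using that n vertical.prems by auto
    moreover have "x < q" if "y = p" using that n vertical.prems by auto
    ultimately show ?thesis using vertical.prems(7) by auto
  qed
  then show ?case using vertical.prems n by (intro vertical.IH) auto
next
  case (diagonal p q ps)
  have r: "Suc p \<le> u \<and> u \<le> a \<and> a \<le> b \<and> b \<le> v \<and> v \<le> q" if "(u, v) \<in> set ((Suc p, q) # ps)" for u v
    using peeling_range[OF diagonal.hyps(3) that] peeling_last_ordered[OF diagonal.hyps(3)]
      diagonal.prems(1) by auto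
  have pq: "Suc p \<le> q" using r[of "Suc p" q] by auto
  have n: "x \<noteq> Suc q" "y \<noteq> Suc q" using diagonal.prems r pq by force+
  show ?case
  proof (cases "x = p \<or> y = p")
    case True
    then show ?thesis using diagonal.hyps(1) diagonal.prems(2,3) n by (auto simp: absorbing_on_def)
  next
    case False
    then show ?thesis using diagonal.prems n by (intro diagonal.IH) auto
  qed
qed auto

text \<open>A pair containing an absorbing element commutes. Outside the final block, the only pairs
  in which neither element is known to absorb the other are the corners of diagonal steps.\<close>

lemma peeling_symmetric:
  assumes "peeling F ps" and "last ps = (a, b)"
    and "x \<in> {fst (hd ps)..snd (hd ps)}" and "y \<in> {fst (hd ps)..snd (hd ps)}"
    and "(x, y) \<notin> {a..b} \<times> {a..b}"
    and "\<And>i. Suc i < length ps \<Longrightarrow> diagonal (ps ! i) (ps ! Suc i) \<Longrightarrow>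
      (x, y) \<noteq> ps ! i \<and> (y, x) \<noteq> ps ! i"
  shows "F x y = F y x"
  using assms
proof (induction arbitrary: x y rule: peeling.induct)
  case (horizontal p q ps)
  show ?case
  proof (cases "x = p \<or> y = p")
    case True
    then show ?thesis using horizontal.hyps(1) horizontal.prems(2,3) by (auto simp: absorbing_on_def)
  next
    case False
    \<comment> \<open>Index \<open>i\<close> of the tail is index \<open>Suc i\<close> of the whole
      path, hence the shifted instance.\<close>
    then show ?thesis using horizontal.prems(1-4) horizontal.prems(5)[of "Suc _"]
      by (intro horizontal.IH) auto
  qed
next
  case (vertical p q ps)
  show ?case
  proof (cases "x = Suc q \<or> y = Suc q")
    case True
    then show ?thesis using vertical.hyps(1) vertical.prems(2,3) by (auto simp: absorbing_on_def)
  next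
    case False
    then show ?thesis using vertical.prems(1-4) vertical.prems(5)[of "Suc _"]
      by (intro vertical.IH) auto
  qed
next
  case (diagonal p q ps)
  have c: "(x, y) \<noteq> (p, Suc q)" "(y, x) \<noteq> (p, Suc q)"
    using diagonal.prems(5)[of 0] by (auto simp: diagonal_def diagonal_step_def)
  show ?case
  proof (cases "x \<in> {p, Suc q} \<or> y \<in> {p, Suc q}")
    case True
    then show ?thesis using diagonal.hyps(1,2) diagonal.prems(2,3) c
      by (auto simp: absorbing_on_def le_Suc_eq)
  next
    case False
    then show ?thesis using diagonal.prems(1-4) diagonal.prems(5)[of "Suc _"]
      by (intro diagonal.IH) auto
  qed
qed auto

section \<open>Existence of a peeling\<close>

locale chain_semigroup =
  fixes k :: nat and F :: "nat \<Rightarrow> nat \<Rightarrow> nat"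
  assumes assoc: "associative k F"
    and quasi: "quasitrivial k F"
    and mono: "nondecreasing k F"
begin

lemma value_cases: "x \<in> L k \<Longrightarrow> y \<in> L k \<Longrightarrow> F x y = x \<or> F x y = y"
  using quasi by (auto simp: quasitrivial_def)

lemma F_assoc: "x \<in> L k \<Longrightarrow> y \<in> L k \<Longrightarrow> z \<in> L k \<Longrightarrow> F (F x y) z = F x (F y z)"
  using assoc by (auto simp: associative_def)

lemma F_mono:
  "x \<in> L k \<Longrightarrow> y \<in> L k \<Longrightarrow> x' \<in> L k \<Longrightarrow> y' \<in> L k \<Longrightarrow> x \<le> x' \<Longrightarrow> y \<le> y' \<Longrightarrow> F x y \<le> F x' y'"
  using mono unfolding nondecreasing_def by blast

text \<open>The axioms are self-dual, so every fact below also holds with the arguments of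
  \<open>F\<close> exchanged.\<close>

lemma swap: "chain_semigroup k (\<lambda>x y. F y x)"
  using assoc quasi mono
  by (unfold_locales) (auto simp: associative_def quasitrivial_def nondecreasing_def)

lemma interval_L: "p \<in> L k \<Longrightarrow> q \<in> L k \<Longrightarrow> z \<in> {p..q} \<Longrightarrow> z \<in> L k"
  by (auto simp: L_def)

text \<open>Monotonicity bounds \<open>F p z\<close> by \<open>p\<close>, while quasitriviality
  leaves only \<open>p\<close> or \<open>z \<ge> p\<close>. Together with its dual this makes
  \<open>p\<close> absorbing when both corner values are \<open>p\<close>.\<close>

lemma left_corner:
  assumes "p \<in> L k" "q \<in> L k" "F p q = p" "z \<in> {p..q}"
  shows "F p z = p"
proof -
  have z: "z \<in> L k" using interval_L assms by blast
  have "F p z \<le> F p q" using F_mono[of p z p q] assms z by auto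
  then show ?thesis using value_cases[OF assms(1) z] assms by auto
qed

lemma right_corner:
  assumes "p \<in> L k" "q \<in> L k" "F q p = q" "z \<in> {p..q}"
  shows "F q z = q"
proof -
  have z: "z \<in> L k" using interval_L assms by blast
  have "F q p \<le> F q z" using F_mono[of q p q z] assms z by auto
  then show ?thesis using value_cases[OF assms(2) z] assms by auto
qed

text \<open>If the corner values follow the first projection, an inner element either acts as the
  first projection on both endpoints or is absorbed by both; monotonicity forbids a mixture.\<close>

lemma corners_Proj_x:
  assumes pq: "p \<in> L k" "q \<in> L k" "p < q" and c: "F p q = p" "F q p = q"
  shows "agrees_on ({p..q} \<times> {p..q}) F Proj_x \<or>
    absorbing_on {p..<q} F p \<and> absorbing_on {p<..q} F q \<and> Suc p < q"
proof (cases "\<exists>z\<in>{p<..<q}. F z p = p")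
  case False
  have zp: "F z p = z" if "z \<in> {p..q}" for z
    using that False value_cases[OF interval_L[OF pq(1,2) that] pq(1)] c
    by (cases "z = p"; cases "z = q") auto
  \<comment> \<open>Associativity carries the identity to the other endpoint:
    \<open>F z q = F (F z p) q = F z (F p q) = F z p = z\<close>. Monotonicity then squeezes
    \<open>F z w\<close> between \<open>F z p\<close> and \<open>F z q\<close>.\<close>
  have zq: "F z q = z" if z: "z \<in> {p..q}" for z
  proof -
    have "z \<in> L k" using interval_L pq z by blast
    then have "F (F z p) q = F z (F p q)" using F_assoc pq by blast
    then show ?thesis using zp[OF z] c by simp
  qed
  have "F z w = z" if "z \<in> {p..q}" "w \<in> {p..q}" for z w
  proof (rule antisym)
    have L: "z \<in> L k" "w \<in> L k" using interval_L pq that by blast+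
    show "F z w \<le> z" using F_mono[of z w z q] zq[OF that(1)] L pq that by auto
    show "z \<le> F z w" using F_mono[of z p z w] zp[OF that(1)] L pq that by auto
  qed
  then show ?thesis by (auto simp: agrees_on_def Proj_x_def)
next
  case True
  then obtain z where z: "z \<in> {p<..<q}" "F z p = p" by auto
  have zL: "z \<in> L k" using z interval_L[OF pq(1,2)] by auto
  \<comment> \<open>By the two associativity identities below, \<open>F w p = w\<close> and
    \<open>F w q = w\<close> imply each other; otherwise both endpoints absorb \<open>w\<close> from
    the right.\<close>
  have either: "F w p = p \<and> F w q = q \<or> F w p = w \<and> F w q = w" if "w \<in> {p<..<q}" for w
  proof -
    have w: "w \<in> L k" using that interval_L[OF pq(1,2)] by auto
    have "F (F w p) q = F w p" "F (F w q) p = F w q" using F_assoc pq w c by auto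
    then show ?thesis using value_cases[OF w pq(1)] value_cases[OF w pq(2)] that c by auto
  qed
  have zq: "F z q = q" using either[OF z(1)] z by auto
  have absorbed: "F w p = p \<and> F w q = q" if w: "w \<in> {p<..<q}" for w
  proof (rule ccontr)
    assume "\<not> ?thesis"
    then have e: "F w p = w" "F w q = w" using either[OF w] by auto
    have wL: "w \<in> L k" using w interval_L[OF pq(1,2)] by auto
    \<comment> \<open>For \<open>w \<le> z\<close>, monotonicity gives
      \<open>w = F w p \<le> F z p = p\<close>; for \<open>w > z\<close> it gives
      \<open>q = F z q \<le> F w q = w\<close>. Both contradict that \<open>w\<close> is an inner
      element.\<close>
    show False
    proof (cases "w \<le> z")
      case True
      then show False using F_mono[of w p z p] e z w wL zL pq by auto
    next
      case False
      then show False using F_mono[of z q w q] e zq w wL zL pq by auto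
    qed
  qed
  have "F p p = p" "F q q = q" using value_cases pq by blast+
  then have "F w p = p" if "w \<in> {p..<q}" for w using absorbed[of w] that by (cases "w = p") auto
  moreover have "F w q = q" if "w \<in> {p<..q}" for w
    using absorbed[of w] that \<open>F q q = q\<close> by (cases "w = q") auto
  ultimately show ?thesis
    using left_corner[OF pq(1,2) c(1)] right_corner[OF pq(1,2) c(2)] z
    by (auto simp: absorbing_on_def)
qed

lemma corners_Proj_y:
  assumes "p \<in> L k" "q \<in> L k" "p < q" "F p q = q" "F q p = p"
  shows "agrees_on ({p..q} \<times> {p..q}) F Proj_y \<or>
    absorbing_on {p..<q} F p \<and> absorbing_on {p<..q} F q \<and> Suc p < q"
proof -
  interpret swapped: chain_semigroup k "\<lambda>x y. F y x" by (rule swap)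
  show ?thesis using swapped.corners_Proj_x[OF assms(1-3,5,4)]
    by (auto simp: agrees_on_def absorbing_on_def Proj_x_def Proj_y_def)
qed

lemma peeling_exists:
  assumes "p \<in> L k" "q \<in> L k" "p \<le> q"
  shows "\<exists>ps. peeling F ((p, q) # ps)"
  using assms
proof (induction "q - p" arbitrary: p q rule: less_induct)
  case less
  interpret swapped: chain_semigroup k "\<lambda>x y. F y x" by (rule swap)
  note L = less.prems(1,2)
  show ?case
  proof (cases "p = q")
    case True
    then have "agrees_on ({p..q} \<times> {p..q}) F Proj_x"
      using value_cases[OF L] by (auto simp: agrees_on_def Proj_x_def)
    then show ?thesis using peeling.stop[of p q F] less.prems by auto
  next
    case False
    then have pq: "p < q" using less.prems by simp
    then obtain q' where q': "q = Suc q'" by (cases q) auto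
    have inL: "Suc p \<in> L k" "q' \<in> L k" using L pq q' by (auto simp: L_def)
    consider "F p q = p" "F q p = p" | "F p q = q" "F q p = q"
      | "agrees_on ({p..q} \<times> {p..q}) F Proj_x \<or> agrees_on ({p..q} \<times> {p..q}) F Proj_y"
      | "absorbing_on {p..<q} F p" "absorbing_on {p<..q} F q" "Suc p < q"
      using value_cases[OF L] value_cases[OF L(2,1)] corners_Proj_x[OF L pq] corners_Proj_y[OF L pq]
      by metis
    then show ?thesis
    proof cases
      case 1
      then have "absorbing_on {p..q} F p"
        using left_corner[OF L] swapped.left_corner[OF L] by (auto simp: absorbing_on_def)
      moreover obtain ps where "peeling F ((Suc p, q) # ps)"
        using less.hyps[of q "Suc p"] inL L pq by force
      ultimately show ?thesis using peeling.horizontal by blast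
    next
      case 2
      then have "absorbing_on {p..Suc q'} F (Suc q')"
        using right_corner[OF L] swapped.right_corner[OF L] by (auto simp: absorbing_on_def q')
      moreover obtain ps where "peeling F ((p, q') # ps)"
        using less.hyps[of q' p] inL L pq q' by force
      ultimately show ?thesis using peeling.vertical q' by blast
    next
      case 3
      then show ?thesis using peeling.stop[of p q F] less.prems by auto
    next
      case 4
      have "{p..<q} = {p..q'}" "{p<..q} = {Suc p..Suc q'}" using q' by auto
      then have "absorbing_on {p..q'} F p" "absorbing_on {Suc p..Suc q'} F (Suc q')"
        using 4 q' by auto
      \<comment> \<open>\<open>Suc p < q\<close> makes the interval from \<open>Suc p\<close> to
        \<open>q'\<close> nonempty, as the induction hypothesis requires.\<close>
      moreover obtain ps where "peeling F ((Suc p, q') # ps)"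
        using less.hyps[of q' "Suc p"] inL L 4 q' by force
      ultimately show ?thesis using peeling.diagonal q' by blast
    qed
  qed
qed

end

section \<open>Reading the theorem off a peeling of the whole chain\<close>

theorem theorem4p12:
  fixes k :: nat and F :: "nat \<Rightarrow> nat \<Rightarrow> nat"
  assumes "k \<ge> 1"
    and "operation_on k F"
    and "associative k F"
    and "quasitrivial k F"
    and "nondecreasing k F"
  shows "\<exists>e f a b ps qs.
    upper_half_neutral k F e \<and> lower_half_neutral k F f \<and>
    a = min e f \<and> b = max e f \<and> a \<le> b \<and>
    path_from_to k ps (1, k) (a, b) \<and> length ps \<le> k \<and> qs = reflection ps \<and>
    \<comment> \<open>(1)\<close>
    (\<forall>x\<in>L k. \<forall>y\<in>L k. (x, y) \<notin> set ps \<union> set qs \<longrightarrow>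
       (above_paths k a b ps (x, y) \<longrightarrow> F x y = max x y) \<and>
       (below_paths k a b ps (x, y) \<longrightarrow> F x y = min x y)) \<and>
    (agrees_on ({a..b} \<times> {a..b} - (set ps \<union> set qs)) F Proj_x \<or>
     agrees_on ({a..b} \<times> {a..b} - (set ps \<union> set qs)) F Proj_y) \<and>
    \<comment> \<open>(2)\<close>
    (\<forall>x y i. Suc i < length ps \<longrightarrow>
       ((x, y) = ps ! i \<or> (x, y) = qs ! i) \<and> horizontal (ps ! i) (ps ! Suc i) \<longrightarrow>
       F x y = min x y) \<and>
    (\<forall>x y i. Suc i < length ps \<longrightarrow>
       ((x, y) = ps ! i \<or> (x, y) = qs ! i) \<and> vertical (ps ! i) (ps ! Suc i) \<longrightarrow>
       F x y = max x y) \<and>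
    (\<forall>x y i. Suc i < length ps \<longrightarrow>
       (x, y) = ps ! i \<and> diagonal (ps ! i) (ps ! Suc i) \<longrightarrow> F x y = x \<or> F x y = y) \<and>
    (\<forall>x y i. Suc i < length ps \<longrightarrow>
       (x, y) = qs ! i \<and> diagonal (qs ! i) (qs ! Suc i) \<longrightarrow> F x y = x \<or> F x y = y) \<and>
    \<comment> \<open>(3)\<close>
    (if a = f \<and> b = e then agrees_on ({a..b} \<times> {a..b}) F Proj_x
     else agrees_on ({a..b} \<times> {a..b}) F Proj_y) \<and>
    \<comment> \<open>(4)\<close>
    (\<forall>z \<in> L k \<times> L k.
       z \<notin> {a..b} \<times> {a..b} \<and>
       \<not> (\<exists>i. Suc i < length ps \<and> diagonal (ps ! i) (ps ! Suc i) \<and> (z = ps ! i \<or> z = qs ! i)) \<longrightarrow>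
       symmetric_at F z)"
proof -
  interpret chain_semigroup k F using assms by unfold_locales
  have kL: "1 \<in> L k" "k \<in> L k" using assms(1) by (auto simp: L_def)
  obtain ps where ps: "peeling F ps" "hd ps = (1, k)"
    using peeling_exists[OF kL assms(1)] by auto
  obtain a b where ab: "last ps = (a, b)" by (cases "last ps")
  have le: "a \<le> b" using peeling_last_ordered[OF ps(1)] ab by simp
  note nonempty = peeling_nonempty[OF ps(1)]
  have square: "set ps \<subseteq> L k \<times> L k"
  proof
    fix z assume z: "z \<in> set ps"
    obtain x y where xy: "z = (x, y)" by (cases z)
    have "(a, b) \<in> set ps" using ab last_in_set[OF nonempty] by simp
    then show "z \<in> L k \<times> L k"
      using peeling_range[OF ps(1), of x y] peeling_range[OF ps(1), of a b] z xy ps(2) ab le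
      by (auto simp: L_def)
  qed
  have path: "path_from_to k ps (1, k) (a, b)"
    using nonempty square peeling_step[OF ps(1)] ps(2) ab
    by (simp add: path_from_to_def downward_right_path_def)
  have len: "length ps \<le> k" using peeling_length[OF ps(1)] ps(2) by simp
  obtain e f where ef: "upper_half_neutral k F e" "lower_half_neutral k F f"
    "a = min e f" "b = max e f"
    and proj: "if a = f \<and> b = e then agrees_on ({a..b} \<times> {a..b}) F Proj_x
      else agrees_on ({a..b} \<times> {a..b}) F Proj_y"
  proof -
    consider "agrees_on ({a..b} \<times> {a..b}) F Proj_x" | "agrees_on ({a..b} \<times> {a..b}) F Proj_y"
      using peeling_last_projection[OF ps(1) ab] by blast
    then show ?thesis
    proof cases
      \<comment> \<open>On a first-projection block \<open>F x b = x\<close> and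
        \<open>F x a = x\<close>, so \<open>b\<close> is the upper and \<open>a\<close> the lower
        half-neutral element. For the second projection the roles are exchanged.\<close>
      case 1
      then have "upper_half_neutral k F b \<and> lower_half_neutral k F a"
        using le by (intro peeling_half_neutral[OF ps ab])
          (auto simp: agrees_on_def Proj_x_def upper_symmetrization_def lower_symmetrization_def)
      then show ?thesis using that[of b a] 1 le by auto
    next
      case 2
      then have "upper_half_neutral k F a \<and> lower_half_neutral k F b"
        using le by (intro peeling_half_neutral[OF ps ab])
          (auto simp: agrees_on_def Proj_y_def upper_symmetrization_def lower_symmetrization_def)
      \<comment> \<open>If \<open>a = b\<close>, the conditional selects the first projection, which
        coincides with the second on a single point.\<close>
      moreover have "agrees_on ({a..b} \<times> {a..b}) F Proj_x" if "a = b"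
        using 2 that by (auto simp: agrees_on_def Proj_x_def Proj_y_def)
      then have "if a = b \<and> b = a then agrees_on ({a..b} \<times> {a..b}) F Proj_x
        else agrees_on ({a..b} \<times> {a..b}) F Proj_y" using 2 unfolding if_bool_eq_conj by blast
      moreover have "a = min a b" "b = max a b" using le by auto
      ultimately show ?thesis using that[of a b] by blast
    qed
  qed
  define qs where "qs = reflection ps"
  have qs_nth: "(x, y) = qs ! i \<longleftrightarrow> (y, x) = ps ! i" if "i < length ps" for x y i
    using that by (cases "ps ! i") (auto simp: qs_def reflection_def)
  have qs_set: "(x, y) \<in> set qs \<longleftrightarrow> (y, x) \<in> set ps" for x y
    by (force simp: qs_def reflection_def)
  \<comment> \<open>Through \<open>qs_set\<close>, witnesses \<open>(w, y)\<close> on the reflection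
    become \<open>(y, w)\<close> on the path, the form used for the values above and below.\<close>
  have off_path:
    "(above_paths k a b ps (x, y) \<longrightarrow> F x y = max x y) \<and>
     (below_paths k a b ps (x, y) \<longrightarrow> F x y = min x y)" for x y
    using peeling_above[OF ps(1) ab, of x y] peeling_below[OF ps(1) ab, of x y] ps(2)
    by (auto simp: above_paths_def below_paths_def qs_def[symmetric] qs_set L_def)
  have hor: "F x y = min x y" if "Suc i < length ps" "(x, y) = ps ! i \<or> (x, y) = qs ! i"
    "horizontal (ps ! i) (ps ! Suc i)" for x y i
    using peeling_horizontal[OF ps(1) that(1,3), of x y]
      peeling_horizontal[OF ps(1) that(1,3), of y x] that(1,2) qs_nth[of i x y] by auto
  have ver: "F x y = max x y" if "Suc i < length ps" "(x, y) = ps ! i \<or> (x, y) = qs ! i"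
    "vertical (ps ! i) (ps ! Suc i)" for x y i
    using peeling_vertical[OF ps(1) that(1,3), of x y]
      peeling_vertical[OF ps(1) that(1,3), of y x] that(1,2) qs_nth[of i x y] by auto
  \<comment> \<open>Quasitriviality gives this at every path point and its mirror image, whatever
    the orientation of the step.\<close>
  have dia: "F x y = x \<or> F x y = y" if "Suc i < length ps" "(x, y) = ps ! i \<or> (x, y) = qs ! i"
    for x y i
  proof -
    have "ps ! i \<in> L k \<times> L k" using square that(1) by (meson Suc_lessD nth_mem subsetD)
    moreover have "ps ! i = (x, y) \<or> ps ! i = (y, x)" using that qs_nth by (metis Suc_lessD)
    ultimately have "x \<in> L k" "y \<in> L k" by auto
    then show ?thesis by (rule value_cases)
  qed
  have sym: "symmetric_at F z" if z: "z \<in> L k \<times> L k" "z \<notin> {a..b} \<times> {a..b}"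
    and d: "\<not> (\<exists>i. Suc i < length ps \<and> diagonal (ps ! i) (ps ! Suc i) \<and> (z = ps ! i \<or> z = qs ! i))"
    for z
  proof -
    obtain x y where xy: "z = (x, y)" by (cases z)
    have "F x y = F y x"
    proof (rule peeling_symmetric[OF ps(1) ab])
      show "(x, y) \<noteq> ps ! i \<and> (y, x) \<noteq> ps ! i"
        if "Suc i < length ps" "diagonal (ps ! i) (ps ! Suc i)" for i
        using d that qs_nth xy by (metis Suc_lessD)
    qed (use z xy ps(2) in \<open>auto simp: L_def\<close>)
    then show ?thesis using xy by (simp add: symmetric_at_def)
  qed
  have proj': "agrees_on ({a..b} \<times> {a..b} - (set ps \<union> set qs)) F Proj_x \<or>
    agrees_on ({a..b} \<times> {a..b} - (set ps \<union> set qs)) F Proj_y"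
    using peeling_last_projection[OF ps(1) ab] by (auto simp: agrees_on_def)
  show ?thesis
    apply (rule exI[of _ e], rule exI[of _ f], rule exI[of _ a], rule exI[of _ b],
        rule exI[of _ ps], rule exI[of _ qs])
    apply (intro conjI)
                   apply (fact ef le path len qs_def)+
           apply (use off_path in blast)
          apply (fact proj')
         apply (use hor in blast)
        apply (use ver in blast)
       apply (use dia in blast)
      apply (use dia in blast)
     apply (fact proj)
    apply (use sym in blast)
    done
qed

end
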